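(* Consider the system of equations in $(a,b,c,d)\in\mathbb{C}^4$ with $b\neq 0$: $$a^2=1,$$ $$b^2+\frac{4c}{b}-c^2-4cd+bc^2d+2bcd^2=0,$$ $$-2+2bc+\frac{2c^2}{b^2}-\frac{c^4}{4}+2bd-\frac{2c^2d}{b}+c^2d^2=0,$$ $$-\frac{2}{b^2}+\frac{2d}{b}-d^2=0.$$ Let $K\subset\mathbb{C}$ be the field generated over $\mathbb{Q}$ by the coordinates of all solutions. Then $K/\mathbb{Q}$ is a finite Galois extension whose Galois group, which permutes the solutions (acting coordinatewise), is isomorphic to $V_4=C_2\times C_2$. The solutions comprise exactly eight orbits for this Galois action, and each orbit has $4$ elements.
   Context: $C_2$ denotes the cyclic group of order 2 and $V_4$ the Klein four-group. The condition $b\neq0$ is implicit in the equations, which contain divisions by $b$ and $b^2$. *)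

theory Defs
  imports "HOL-Algebra.Algebra" "HOL-Algebra.Algebraic_Closure_Type"
begin

text \<open>The field \<open>\<complex>\<close> as a record in the sense of HOL-Algebra.\<close>

abbreviation complex_field :: "complex ring"
  where "complex_field \<equiv> ring_of_type_algebra"

text \<open>
  \<open>Gal(K/F)\<close> for subsets \<open>F \<subseteq> K\<close> of an ambient ring \<open>R\<close>. An automorphism of \<open>K\<close> is represented
  by the unique function that agrees with it on \<open>K\<close> and is \<open>undefined\<close> elsewhere; this is the
  representation of permutations used by \<^const>\<open>BijGroup\<close>.
\<close>

definition galois_group :: "('a, 'b) ring_scheme \<Rightarrow> 'a set \<Rightarrow> 'a set \<Rightarrow> ('a \<Rightarrow> 'a) monoid"
  where "galois_group R K F = BijGroup K
    \<lparr>carrier := {\<sigma> \<in> extensional K. \<sigma> \<in> ring_iso (R\<lparr>carrier := K\<rparr>) (R\<lparr>carrier := K\<rparr>) \<and>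
                                (\<forall>x\<in>F. \<sigma> x = x)}\<rparr>"

text \<open>
  Galois extensions in the sense of Artin: \<open>F\<close> is the fixed field of \<open>Gal(K/F)\<close>.
\<close>

definition finite_galois_extension :: "('a, 'b) ring_scheme \<Rightarrow> 'a set \<Rightarrow> 'a set \<Rightarrow> bool"
  where "finite_galois_extension R K F \<longleftrightarrow>
    subfield K R \<and> subfield F R \<and> F \<subseteq> K \<and> ring.finite_dimension R F K \<and>
    {x \<in> K. \<forall>\<sigma>\<in>carrier (galois_group R K F). \<sigma> x = x} = F"

definition solutions :: "(complex \<times> complex \<times> complex \<times> complex) set"
  where "solutions = {(a, b, c, d).
    b \<noteq> 0 \<and>
    a^2 = 1 \<and>
    b^2 + 4 * c / b - c^2 - 4 * c * d + b * c^2 * d + 2 * b * c * d^2 = 0 \<and>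
    - 2 + 2 * b * c + 2 * c^2 / b^2 - c^4 / 4 + 2 * b * d - 2 * c^2 * d / b + c^2 * d^2 = 0 \<and>
    - 2 / b^2 + 2 * d / b - d^2 = 0}"

definition solution_field :: "complex set"
  where "solution_field =
    generate_field complex_field (\<rat> \<union> (\<Union>(a, b, c, d)\<in>solutions. {a, b, c, d}))"

abbreviation solution_galois_group :: "(complex \<Rightarrow> complex) monoid"
  where "solution_galois_group \<equiv> galois_group complex_field solution_field \<rat>"

text \<open>
  The restriction to the solution set is needed for the values to be elements of
  \<open>BijGroup solutions\<close>, as \<^locale>\<open>group_action\<close> requires.
\<close>

definition coordinatewise ::
    "(complex \<Rightarrow> complex) \<Rightarrow> complex \<times> complex \<times> complex \<times> complex
      \<Rightarrow> complex \<times> complex \<times> complex \<times> complex"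
  where "coordinatewise \<sigma> = (\<lambda>(a, b, c, d)\<in>solutions. (\<sigma> a, \<sigma> b, \<sigma> c, \<sigma> d))"

end

theory Submission
  imports Defs
begin

text \<open>
  The unknown \<open>a\<close> is a free sign. For the others put \<open>s = b d - 1\<close>. Up to the factor \<open>-1/b\<^sup>2\<close> the
  last equation says \<open>s\<^sup>2 + 1 = 0\<close>, and modulo this relation the second and the third become
  \<open>b\<^sup>2 = - s c\<^sup>2\<close> and \<open>c\<^sup>4 = 8 b c + 8 s\<close> (lemma \<open>system_reduced\<close>). Hence \<open>t = b / c\<close> has \<open>t\<^sup>2 = - s\<close>
  and is a primitive eighth root of unity, and \<open>c\<close> is a root of \<open>X\<^sup>4 - 8 t X\<^sup>2 + 8 t\<^sup>2\<close>.

  The point is that this quartic splits over \<open>\<rat>(t)\<close>. Solving for the square gives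
  \<open>c\<^sup>2 = 2 t (2 \<plusminus> \<surd>2)\<close>. As \<open>t + 1/t\<close> is a square root of \<open>2\<close>, the two values are \<open>2 (1 + t)\<^sup>2\<close> and
  \<open>- 2 (1 - t)\<^sup>2\<close>, and \<open>\<rat>(t)\<close> contains square roots of \<open>2\<close> and \<open>- 2\<close>, namely \<open>t - t\<^sup>3\<close> and
  \<open>t + t\<^sup>3\<close>. So a solution is determined by three signs (\<open>a\<close>, the choice \<open>m\<close> of the factor, the
  choice \<open>e\<close> of the root \<open>c\<close>) and by \<open>t\<close>, and for fixed signs its coordinates are rational
  functions of \<open>t\<close> over \<open>\<rat>\<close> (lemmas \<open>solutions_eq\<close> and \<open>sol_inject\<close>).

  Everything else follows. The coordinates generate the eighth cyclotomic field, which is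
  \<open>\<rat>(i, \<surd>2)\<close> (lemma \<open>solution_field_eq\<close>); its automorphisms are the four independent choices of
  sign for \<open>i\<close> and \<open>\<surd>2\<close>, a Klein four-group. They preserve the three signs and permute the four
  values of \<open>t\<close> transitively, so each of the eight choices of signs is one orbit, with
  four elements (lemma \<open>orbits_solutions\<close>).
\<close>

section \<open>Type-class fields as records\<close>

lemma type_algebra_simps [simp]:
  "carrier (ring_of_type_algebra :: 'a::field ring) = UNIV"
  "x \<otimes>\<^bsub>(ring_of_type_algebra :: 'a ring)\<^esub> y = x * y"
  "x \<oplus>\<^bsub>(ring_of_type_algebra :: 'a ring)\<^esub> y = x + y"
  "\<one>\<^bsub>(ring_of_type_algebra :: 'a ring)\<^esub> = 1"
  "\<zero>\<^bsub>(ring_of_type_algebra :: 'a ring)\<^esub> = 0"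
  by (simp_all add: ring_of_type_algebra_def)

lemma a_inv_type_algebra [simp]:
  "\<ominus>\<^bsub>(ring_of_type_algebra :: 'a::field ring)\<^esub> x = - x"
proof -
  interpret field "ring_of_type_algebra :: 'a ring" ..
  show ?thesis
    by (rule minus_equality) auto
qed

lemma m_inv_type_algebra [simp]:
  assumes "x \<noteq> 0"
  shows "inv\<^bsub>(ring_of_type_algebra :: 'a::field ring)\<^esub> x = inverse x"
proof -
  interpret field "ring_of_type_algebra :: 'a ring" ..
  show ?thesis
    using assms by (intro inv_char) auto
qed

lemma subfield_type_algebraI:
  fixes K :: "'a::field set"
  assumes "1 \<in> K"
    and "\<And>x y. \<lbrakk>x \<in> K; y \<in> K\<rbrakk> \<Longrightarrow> x + y \<in> K"
    and "\<And>x y. \<lbrakk>x \<in> K; y \<in> K\<rbrakk> \<Longrightarrow> x * y \<in> K"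
    and "\<And>x. x \<in> K \<Longrightarrow> - x \<in> K"
    and "\<And>x. \<lbrakk>x \<in> K; x \<noteq> 0\<rbrakk> \<Longrightarrow> inverse x \<in> K"
  shows "subfield K ring_of_type_algebra"
proof -
  interpret field "ring_of_type_algebra :: 'a ring" ..
  show ?thesis
    by (rule subfieldI', rule subringI) (use assms in auto)
qed

lemma subfield_type_algebraD:
  fixes K :: "'a::field set"
  assumes K: "subfield K ring_of_type_algebra"
  shows "1 \<in> K"
    and "\<lbrakk>x \<in> K; y \<in> K\<rbrakk> \<Longrightarrow> x + y \<in> K"
    and "\<lbrakk>x \<in> K; y \<in> K\<rbrakk> \<Longrightarrow> x * y \<in> K"
    and "x \<in> K \<Longrightarrow> - x \<in> K"
    and "x \<in> K \<Longrightarrow> inverse x \<in> K"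
    and "\<lbrakk>x \<in> K; y \<in> K\<rbrakk> \<Longrightarrow> x - y \<in> K"
    and "x \<in> K \<Longrightarrow> x ^ n \<in> K"
proof -
  interpret field "ring_of_type_algebra :: 'a ring" ..
  note closed = subringE[OF subfieldE(1)[OF K], simplified]
  show one: "1 \<in> K" and add: "\<lbrakk>x \<in> K; y \<in> K\<rbrakk> \<Longrightarrow> x + y \<in> K"
    and mult: "\<lbrakk>x \<in> K; y \<in> K\<rbrakk> \<Longrightarrow> x * y \<in> K" and minus: "x \<in> K \<Longrightarrow> - x \<in> K" for x y
    using closed by auto
  show "inverse x \<in> K" if "x \<in> K"
    using subfield_m_inv(1)[OF K, of x] that by (cases "x = 0") auto
  show "x - y \<in> K" if "x \<in> K" "y \<in> K"
    using add[OF that(1) minus[OF that(2)]] by simp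
  show "x ^ n \<in> K" if "x \<in> K"
    by (induction n) (use one mult that in auto)
qed

lemma subfield_Rats: "subfield \<rat> complex_field"
  by (rule subfield_type_algebraI) auto

section \<open>Galois groups and group actions\<close>

lemma Bij_galois_group:
  "\<sigma> \<in> carrier (galois_group R K F) \<Longrightarrow> \<sigma> \<in> Bij K"
  by (auto simp: galois_group_def Bij_def ring_iso_def)

lemma mult_galois_group:
  assumes "\<sigma> \<in> carrier (galois_group R K F)" "\<tau> \<in> carrier (galois_group R K F)"
  shows "\<sigma> \<otimes>\<^bsub>galois_group R K F\<^esub> \<tau> = compose K \<sigma> \<tau>"
  using Bij_galois_group[OF assms(1)] Bij_galois_group[OF assms(2)]
  by (simp add: galois_group_def BijGroup_def)

lemma one_galois_group: "\<one>\<^bsub>galois_group R K F\<^esub> = (\<lambda>x\<in>K. x)"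
  by (simp add: galois_group_def BijGroup_def)

lemma galois_group_hom:
  fixes K F :: "'a::field set"
  assumes K: "subfield K ring_of_type_algebra"
    and \<sigma>: "\<sigma> \<in> carrier (galois_group ring_of_type_algebra K F)"
  shows "x \<in> K \<Longrightarrow> \<sigma> x \<in> K"
    and "x \<in> F \<Longrightarrow> \<sigma> x = x"
    and "\<lbrakk>x \<in> K; y \<in> K\<rbrakk> \<Longrightarrow> \<sigma> (x + y) = \<sigma> x + \<sigma> y"
    and "\<lbrakk>x \<in> K; y \<in> K\<rbrakk> \<Longrightarrow> \<sigma> (x - y) = \<sigma> x - \<sigma> y"
    and "\<lbrakk>x \<in> K; y \<in> K\<rbrakk> \<Longrightarrow> \<sigma> (x * y) = \<sigma> x * \<sigma> y"
    and "\<lbrakk>x \<in> K; y \<in> K\<rbrakk> \<Longrightarrow> \<sigma> (x / y) = \<sigma> x / \<sigma> y"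
    and "x \<in> K \<Longrightarrow> \<sigma> (x ^ n) = \<sigma> x ^ n"
proof -
  note K_closed = subfield_type_algebraD[OF K]
  have "\<sigma> \<in> ring_hom (ring_of_type_algebra\<lparr>carrier := K\<rparr>) (ring_of_type_algebra\<lparr>carrier := K\<rparr>)"
    using \<sigma> by (auto simp: galois_group_def ring_iso_def)
  note hom = ring_hom_memE[OF this, simplified]
  show closed: "\<sigma> x \<in> K" if "x \<in> K" for x
    using hom(1) that by blast
  show "\<sigma> x = x" if "x \<in> F"
    using \<sigma> that by (auto simp: galois_group_def)
  show add: "\<sigma> (x + y) = \<sigma> x + \<sigma> y" if "x \<in> K" "y \<in> K" for x y
    using hom(3) that by blast
  show mult: "\<sigma> (x * y) = \<sigma> x * \<sigma> y" if "x \<in> K" "y \<in> K" for x y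
    using hom(2) that by blast
  have one: "\<sigma> 1 = 1" by (rule hom(4))
  have zero_in: "0 \<in> K"
    using K_closed(6)[OF K_closed(1,1)] by simp
  have zero: "\<sigma> 0 = 0"
    using add[of 0 0] zero_in by (metis add_0 add_cancel_left_left)
  have minus: "\<sigma> (- x) = - \<sigma> x" if "x \<in> K" for x
    using add[of x "- x"] K_closed(4) that by (simp add: zero add_eq_0_iff)
  show "\<sigma> (x - y) = \<sigma> x - \<sigma> y" if "x \<in> K" "y \<in> K"
    using add[of x "- y"] that K_closed(4) by (simp add: minus)
  have inverse: "\<sigma> (inverse x) = inverse (\<sigma> x)" if "x \<in> K" for x
  proof (cases "x = 0")
    case False
    then have "\<sigma> x * \<sigma> (inverse x) = 1"
      using mult[of x "inverse x"] that K_closed(5) by (simp add: one)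
    then show ?thesis by (metis inverse_unique)
  qed (simp add: zero)
  show "\<sigma> (x / y) = \<sigma> x / \<sigma> y" if "x \<in> K" "y \<in> K"
    using that mult[of x "inverse y"] K_closed(5) by (simp add: inverse divide_inverse)
  show "\<sigma> (x ^ n) = \<sigma> x ^ n" if "x \<in> K"
    by (induction n) (simp_all add: one mult that K_closed(7))
qed

text \<open>
  The group is a subgroup of \<open>BijGroup K\<close>: inverses and composites of ring isomorphisms are ring
  isomorphisms, and only their values on \<open>K\<close> matter.
\<close>

lemma group_galois_group:
  assumes K: "subring K R" and R: "ring R" and FK: "F \<subseteq> K"
  shows "group (galois_group R K F)"
proof -
  let ?R = "R\<lparr>carrier := K\<rparr>"
  let ?G = "carrier (galois_group R K F)"
  interpret K: ring ?R
    by (rule ring.subring_is_ring[OF R K])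
  have carr: "\<sigma> \<in> ?G \<longleftrightarrow> \<sigma> \<in> extensional K \<and> \<sigma> \<in> ring_iso ?R ?R \<and> (\<forall>x\<in>F. \<sigma> x = x)" for \<sigma>
    by (auto simp: galois_group_def)
  have "subgroup ?G (BijGroup K)"
  proof (rule group.subgroupI[OF group_BijGroup])
    show "?G \<subseteq> carrier (BijGroup K)"
      using Bij_galois_group by (auto simp: BijGroup_def)
    have "(\<lambda>x\<in>K. x) \<in> ring_iso ?R ?R"
      by (rule K.ring_iso_restrict[OF ring_iso_set_refl]) auto
    then show "?G \<noteq> {}"
      using FK carr[of "\<lambda>x\<in>K. x"] by force
  next
    fix \<sigma> assume \<sigma>: "\<sigma> \<in> ?G"
    then have bij: "\<sigma> \<in> Bij K" and inj: "inj_on \<sigma> K"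
      using Bij_galois_group[OF \<sigma>] by (auto simp: Bij_def bij_betw_def)
    have "inv_into K \<sigma> \<in> ring_iso ?R ?R"
      using ring_iso_set_sym[OF K.ring_axioms, of \<sigma> ?R] \<sigma> by (simp add: carr)
    then have "(\<lambda>x\<in>K. inv_into K \<sigma> x) \<in> ring_iso ?R ?R"
      by (rule K.ring_iso_restrict) auto
    moreover have "inv_into K \<sigma> x = x" if "x \<in> F" for x
      using \<sigma> that FK inv_into_f_f[OF inj, of x] by (auto simp: carr)
    ultimately show "inv\<^bsub>BijGroup K\<^esub> \<sigma> \<in> ?G"
      using FK by (auto simp: inv_BijGroup[OF bij] carr)
  next
    fix \<sigma> \<tau> assume \<sigma>\<tau>: "\<sigma> \<in> ?G" "\<tau> \<in> ?G"
    then have bij: "\<sigma> \<in> Bij K" "\<tau> \<in> Bij K"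
      by (simp_all add: Bij_galois_group)
    have "\<sigma> \<circ> \<tau> \<in> ring_iso ?R ?R"
      using \<sigma>\<tau> by (intro ring_iso_set_trans[of \<tau> ?R ?R]) (simp_all add: carr)
    then have "compose K \<sigma> \<tau> \<in> ring_iso ?R ?R"
      by (rule K.ring_iso_restrict) (simp add: compose_def)
    moreover have "compose K \<sigma> \<tau> x = x" if "x \<in> F" for x
      using \<sigma>\<tau> that FK by (simp add: carr compose_def subset_iff)
    ultimately show "\<sigma> \<otimes>\<^bsub>BijGroup K\<^esub> \<tau> \<in> ?G"
      using bij by (simp add: carr BijGroup_def)
  qed
  from subgroup.subgroup_is_group[OF this group_BijGroup] show ?thesis
    by (simp add: galois_group_def)
qed

text \<open>
  Bijectivity of the maps \<open>\<phi> g\<close>, which the notion of a group action demands, comes for free from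
  the algebraic laws: \<open>\<phi>\<close> of the inverse element provides the inverse map.
\<close>

lemma group_actionI:
  assumes G: "group G"
    and ext: "\<And>g. g \<in> carrier G \<Longrightarrow> \<phi> g \<in> extensional E"
    and closed: "\<And>g x. \<lbrakk>g \<in> carrier G; x \<in> E\<rbrakk> \<Longrightarrow> \<phi> g x \<in> E"
    and mult: "\<And>g h x. \<lbrakk>g \<in> carrier G; h \<in> carrier G; x \<in> E\<rbrakk> \<Longrightarrow> \<phi> (g \<otimes>\<^bsub>G\<^esub> h) x = \<phi> g (\<phi> h x)"
    and one: "\<And>x. x \<in> E \<Longrightarrow> \<phi> \<one>\<^bsub>G\<^esub> x = x"
  shows "group_action G E \<phi>"
proof -
  interpret group G by (rule G)
  have inverse: "\<phi> (inv\<^bsub>G\<^esub> g) (\<phi> g x) = x" "\<phi> g (\<phi> (inv\<^bsub>G\<^esub> g) x) = x"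
    if "g \<in> carrier G" "x \<in> E" for g x
    using that mult[of "inv\<^bsub>G\<^esub> g" g x] mult[of g "inv\<^bsub>G\<^esub> g" x] one by simp_all
  have bij: "\<phi> g \<in> Bij E" if "g \<in> carrier G" for g
  proof -
    have "bij_betw (\<phi> g) E E"
      by (rule bij_betw_byWitness[where f' = "\<phi> (inv\<^bsub>G\<^esub> g)"]) (use that inverse closed in auto)
    with ext[OF that] show ?thesis by (simp add: Bij_def)
  qed
  have "\<phi> (g \<otimes>\<^bsub>G\<^esub> h) = compose E (\<phi> g) (\<phi> h)" if "g \<in> carrier G" "h \<in> carrier G" for g h
    using that ext[of "g \<otimes>\<^bsub>G\<^esub> h"] mult by (intro extensionalityI[of _ E]) (auto simp: compose_def)
  then have "\<phi> \<in> hom G (BijGroup E)"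
    using bij by (auto simp: hom_def BijGroup_def)
  then show ?thesis
    using G group_BijGroup
    by (auto simp: group_action_def group_hom_def group_hom_axioms_def)
qed

section \<open>The field Q(i, sqrt 2)\<close>

lemma sqrt_2_irrational: "sqrt 2 \<notin> \<rat>"
proof
  assume "sqrt 2 \<in> \<rat>"
  then obtain m n :: nat where n: "n \<noteq> 0" and mn: "\<bar>sqrt 2\<bar> = real m / real n"
    and "coprime m n"
    by (rule Rats_abs_nat_div_natE)
  have "(sqrt 2)\<^sup>2 = (real m / real n)\<^sup>2"
    using mn by simp
  then have "real (2 * n\<^sup>2) = real (m\<^sup>2)"
    using n by (simp add: field_simps)
  then have eq: "m\<^sup>2 = 2 * n\<^sup>2"
    by (simp only: of_nat_eq_iff)
  then have "even m"
    by (metis dvd_triv_left even_power)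
  then obtain k where "m = 2 * k" ..
  with eq have "even n"
    by (metis dvd_triv_left even_power mult_cancel_left numeral_eq_iff power2_eq_square
        mult.assoc mult.left_commute zero_neq_numeral)
  with \<open>even m\<close> \<open>coprime m n\<close> show False by auto
qed

lemma Rats_sqrt_2_independent:
  "of_rat p + of_rat q * sqrt 2 = of_rat p' + of_rat q' * sqrt 2 \<longleftrightarrow> p = p' \<and> q = q'"
proof
  assume eq: "of_rat p + of_rat q * sqrt 2 = of_rat p' + of_rat q' * sqrt 2"
  have "q = q'"
  proof (rule ccontr)
    assume "q \<noteq> q'"
    then have "(of_rat (q - q') :: real) \<noteq> 0"
      by simp
    moreover have "of_rat (q - q') * sqrt 2 = of_rat (p' - p)"
      using eq by (simp add: of_rat_diff algebra_simps)
    ultimately have "sqrt 2 = of_rat ((p' - p) / (q - q'))"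
      by (simp add: of_rat_divide field_simps)
    with sqrt_2_irrational show False by auto
  qed
  with eq show "p = p' \<and> q = q'" by simp
qed simp

text \<open>
  This is \<open>p + q \<surd>2 + (r + s \<surd>2) i\<close>. With coordinates of type \<^typ>\<open>rat\<close>, the linear independence
  of \<open>1\<close>, \<open>\<surd>2\<close>, \<open>i\<close>, \<open>i \<surd>2\<close> over \<open>\<rat>\<close> is the injectivity of this function; it reduces to that of
  \<open>1\<close>, \<open>\<surd>2\<close> by taking real and imaginary parts.
\<close>

definition biquad :: "rat \<Rightarrow> rat \<Rightarrow> rat \<Rightarrow> rat \<Rightarrow> complex"
  where "biquad p q r s =
    Complex (of_rat p + of_rat q * sqrt 2) (of_rat r + of_rat s * sqrt 2)"

definition biquad_field :: "complex set"
  where "biquad_field = {biquad p q r s | p q r s. True}"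

lemma biquad_eq_iff [simp]:
  "biquad p q r s = biquad p' q' r' s' \<longleftrightarrow> p = p' \<and> q = q' \<and> r = r' \<and> s = s'"
  by (auto simp: biquad_def Rats_sqrt_2_independent)

lemma biquad_in [intro, simp]: "biquad p q r s \<in> biquad_field"
  by (auto simp: biquad_field_def)

lemma biquad_fieldE:
  assumes "z \<in> biquad_field"
  obtains p q r s where "z = biquad p q r s"
  using assms by (auto simp: biquad_field_def)

lemma Re_of_rat [simp]: "Re (of_rat q) = of_rat q"
  and Im_of_rat [simp]: "Im (of_rat q) = 0"
proof -
  have "of_rat q = complex_of_real (of_rat q)"
    by (cases q) (simp add: of_rat_rat)
  then show "Re (of_rat q) = of_rat q" "Im (of_rat q) = 0"
    by simp_all
qed

lemma biquad_add: "biquad p q r s + biquad p' q' r' s' = biquad (p + p') (q + q') (r + r') (s + s')"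
  by (simp add: biquad_def complex_eq_iff of_rat_add algebra_simps)

lemma biquad_minus: "- biquad p q r s = biquad (- p) (- q) (- r) (- s)"
  by (simp add: biquad_def complex_eq_iff of_rat_minus algebra_simps)

lemma biquad_mult: "biquad p q r s * biquad p' q' r' s' =
    biquad (p * p' + 2 * q * q' - r * r' - 2 * s * s') (p * q' + q * p' - r * s' - s * r')
      (p * r' + 2 * q * s' + r * p' + 2 * s * q') (p * s' + q * r' + r * q' + s * p')"
  by (simp add: biquad_def complex_eq_iff of_rat_add of_rat_diff of_rat_mult algebra_simps)

lemma biquad_of_rat: "of_rat q = biquad q 0 0 0"
  by (simp add: biquad_def complex_eq_iff)

lemma biquad_one: "1 = biquad 1 0 0 0"
  using biquad_of_rat[of 1] by simp

lemma biquad_zero: "0 = biquad 0 0 0 0"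
  using biquad_of_rat[of 0] by simp

text \<open>
  This form shows that a ring homomorphism fixing \<open>\<rat>\<close> is determined by its values at \<open>\<surd>2\<close> and \<open>i\<close>.
\<close>

lemma biquad_expand: "biquad p q r s = of_rat p + of_rat q * biquad 0 1 0 0 +
    of_rat r * biquad 0 0 1 0 + of_rat s * (biquad 0 1 0 0 * biquad 0 0 1 0)"
  by (simp add: biquad_of_rat biquad_mult biquad_add)

text \<open>
  The denominator is rationalised in two steps: multiplication by the complex conjugate \<open>y\<close> leads
  into \<open>\<rat>(\<surd>2)\<close>, and multiplication by the conjugate \<open>w\<close> of the product leads into \<open>\<rat>\<close>.
\<close>

lemma biquad_inverse_closed:
  assumes "z \<in> biquad_field" "z \<noteq> 0"
  shows "inverse z \<in> biquad_field"
proof -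
  from assms obtain p q r s where z: "z = biquad p q r s"
    by (blast elim: biquad_fieldE)
  define y where "y = biquad p q (- r) (- s)"
  define P where "P = p\<^sup>2 + 2 * q\<^sup>2 + r\<^sup>2 + 2 * s\<^sup>2"
  define Q where "Q = 2 * p * q + 2 * r * s"
  define w where "w = biquad P (- Q) 0 0"
  have zy: "z * y = biquad P Q 0 0"
    by (simp add: z y_def P_def Q_def biquad_mult power2_eq_square)
  have "y \<noteq> 0"
    using assms(2) by (simp add: z y_def biquad_zero)
  with assms(2) zy have "biquad P Q 0 0 \<noteq> 0"
    by (metis mult_eq_0_iff)
  then have "w \<noteq> 0"
    by (simp add: w_def biquad_zero)
  have zyw: "z * (y * w) = of_rat (P\<^sup>2 - 2 * Q\<^sup>2)"
    by (simp add: zy[symmetric] mult.assoc[symmetric])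
      (simp add: zy w_def biquad_mult biquad_of_rat power2_eq_square)
  have "P\<^sup>2 - 2 * Q\<^sup>2 \<noteq> 0"
    using zyw assms(2) \<open>y \<noteq> 0\<close> \<open>w \<noteq> 0\<close> by auto
  then have "z * (y * w * of_rat (inverse (P\<^sup>2 - 2 * Q\<^sup>2))) = 1"
    using zyw by (simp add: mult.assoc[symmetric] of_rat_mult[symmetric])
  then have "inverse z = y * w * of_rat (inverse (P\<^sup>2 - 2 * Q\<^sup>2))"
    by (rule inverse_unique)
  also have "\<dots> \<in> biquad_field"
    by (simp add: y_def w_def biquad_of_rat biquad_mult)
  finally show ?thesis .
qed

lemma subfield_biquad_field: "subfield biquad_field complex_field"
proof (rule subfield_type_algebraI)
  show "1 \<in> biquad_field"
    by (simp add: biquad_one)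
qed (auto intro: biquad_inverse_closed elim!: biquad_fieldE simp: biquad_add biquad_mult biquad_minus)

lemmas biquad_field_closed = subfield_type_algebraD[OF subfield_biquad_field]

lemma Rats_subset_biquad_field: "\<rat> \<subseteq> biquad_field"
  by (auto simp: Rats_def biquad_of_rat)

lemma finite_dimension_biquad_field: "ring.finite_dimension complex_field \<rat> biquad_field"
proof -
  interpret field complex_field ..
  let ?B = "[biquad 1 0 0 0, biquad 0 1 0 0, biquad 0 0 1 0, biquad 0 0 0 1]"
  have extend: "k * u + v \<in> line_extension \<rat> u E" if "k \<in> \<rat>" "v \<in> E" for k u v :: complex and E
    using that by (auto simp: line_extension_mem_iff)
  have "biquad_field = Span \<rat> ?B"
  proof
    show "Span \<rat> ?B \<subseteq> biquad_field"
      by (auto simp: line_extension_mem_iff Rats_def biquad_of_rat biquad_mult biquad_add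
          biquad_zero)
    show "biquad_field \<subseteq> Span \<rat> ?B"
    proof
      fix z assume "z \<in> biquad_field"
      then obtain p q r s where "z = biquad p q r s"
        by (rule biquad_fieldE)
      then have "z = of_rat p * biquad 1 0 0 0 + (of_rat q * biquad 0 1 0 0 +
          (of_rat r * biquad 0 0 1 0 + (of_rat s * biquad 0 0 0 1 + 0)))"
        by (simp add: biquad_of_rat biquad_mult biquad_add)
      then show "z \<in> Span \<rat> ?B"
        by (simp only: Span.simps foldr.simps o_apply id_apply)
          (intro extend Rats_of_rat, simp)
    qed
  qed
  then show ?thesis
    using Span_finite_dimension[OF subfield_Rats, of ?B] by simp
qed

section \<open>The Galois group of Q(i, sqrt 2)\<close>

text \<open>
  For signs \<open>u\<close> and \<open>v\<close> this is the automorphism with \<open>\<surd>2 \<mapsto> u \<surd>2\<close> and \<open>i \<mapsto> v i\<close>. The value is well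
  defined because the coordinates of an element are unique.
\<close>

definition biquad_conj :: "rat \<Rightarrow> rat \<Rightarrow> complex \<Rightarrow> complex"
  where "biquad_conj u v = (\<lambda>z\<in>biquad_field.
    THE w. \<exists>p q r s. z = biquad p q r s \<and> w = biquad p (u * q) (v * r) (u * v * s))"

lemma biquad_conj_biquad [simp]:
  "biquad_conj u v (biquad p q r s) = biquad p (u * q) (v * r) (u * v * s)"
  by (auto simp: biquad_conj_def intro!: the_equality)

lemma biquad_conj_extensional [simp]: "biquad_conj u v \<in> extensional biquad_field"
  by (simp add: biquad_conj_def)

abbreviation biquad_galois_group :: "(complex \<Rightarrow> complex) monoid"
  where "biquad_galois_group \<equiv> galois_group complex_field biquad_field \<rat>"

text \<open>
  The map respects products because \<open>u\<^sup>2 = v\<^sup>2 = 1\<close>, and for the same reason it is its own inverse.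
\<close>

lemma biquad_conj_in_galois_group:
  assumes "u \<in> {1, - 1}" "v \<in> {1, - 1}"
  shows "biquad_conj u v \<in> carrier biquad_galois_group"
proof -
  have sq: "u * u = 1" "v * v = 1"
    using assms by auto
  then have sq': "u * (u * x) = x" "v * (v * x) = x" for x
    by (simp_all add: mult.assoc[symmetric])
  have "biquad_conj u v \<in> ring_iso (complex_field\<lparr>carrier := biquad_field\<rparr>)
      (complex_field\<lparr>carrier := biquad_field\<rparr>)"
  proof (rule ring_iso_memI)
    show "bij_betw (biquad_conj u v) (carrier (complex_field\<lparr>carrier := biquad_field\<rparr>))
        (carrier (complex_field\<lparr>carrier := biquad_field\<rparr>))"
      by (rule bij_betw_byWitness[where f' = "biquad_conj u v"])
        (auto elim!: biquad_fieldE simp: sq sq' mult_ac)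
  qed (use assms in \<open>auto elim!: biquad_fieldE simp: biquad_mult biquad_add biquad_one algebra_simps\<close>)
  moreover have "biquad_conj u v z = z" if "z \<in> \<rat>" for z
    using that by (elim Rats_cases) (simp add: biquad_of_rat)
  ultimately show ?thesis
    by (simp add: galois_group_def)
qed

text \<open>
  An automorphism sends \<open>\<surd>2\<close> to a square root of \<open>2\<close> and \<open>i\<close> to a square root of \<open>- 1\<close>; these two
  choices of sign determine it.
\<close>

lemma galois_group_eq_biquad_conj:
  "carrier biquad_galois_group = (\<lambda>(u, v). biquad_conj u v) ` ({1, - 1} \<times> {1, - 1})"
proof (intro equalityI subsetI)
  fix \<sigma> assume \<sigma>: "\<sigma> \<in> carrier biquad_galois_group"
  note hom = galois_group_hom[OF subfield_biquad_field \<sigma>]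
  have of_rat [simp]: "\<sigma> (of_rat q) = of_rat q" for q
    by (rule hom(2)) simp
  let ?w = "biquad 0 1 0 0" and ?i = "biquad 0 0 1 0"
  have [simp]: "of_rat q \<in> biquad_field" for q
    by (simp add: biquad_of_rat)
  have "?w * ?w = of_rat 2" "?i * ?i = of_rat (- 1)"
    unfolding biquad_of_rat by (simp_all add: biquad_mult)
  moreover have "\<sigma> ?w * \<sigma> ?w = of_rat 2" "\<sigma> ?i * \<sigma> ?i = of_rat (- 1)"
    using hom(5)[of ?w ?w] hom(5)[of ?i ?i] calculation of_rat by (metis biquad_in)+
  ultimately have "\<sigma> ?w = ?w \<or> \<sigma> ?w = - ?w" "\<sigma> ?i = ?i \<or> \<sigma> ?i = - ?i"
    by (metis square_eq_iff)+
  then have "\<exists>u\<in>{1, - 1}. \<sigma> ?w = of_rat u * ?w" "\<exists>v\<in>{1, - 1}. \<sigma> ?i = of_rat v * ?i"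
    by (simp_all add: of_rat_minus)
  then obtain u v where uv: "u \<in> {1, - 1}" "v \<in> {1, - 1}"
    and w: "\<sigma> ?w = of_rat u * ?w" and i: "\<sigma> ?i = of_rat v * ?i"
    by blast
  have "\<sigma> = biquad_conj u v"
  proof (rule extensionalityI[of _ biquad_field])
    show "\<sigma> \<in> extensional biquad_field"
      using \<sigma> by (simp add: galois_group_def)
    show "biquad_conj u v \<in> extensional biquad_field"
      by simp
    fix z assume "z \<in> biquad_field"
    then obtain p q r s where z: "z = biquad p q r s"
      by (rule biquad_fieldE)
    have "\<sigma> z = of_rat p + of_rat q * \<sigma> ?w + of_rat r * \<sigma> ?i + of_rat s * (\<sigma> ?w * \<sigma> ?i)"
      unfolding z by (subst biquad_expand)
        (simp add: hom biquad_field_closed)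
    also have "\<dots> = biquad_conj u v z"
      by (simp add: z w i biquad_of_rat biquad_mult biquad_add mult_ac)
    finally show "\<sigma> z = biquad_conj u v z" .
  qed
  with uv show "\<sigma> \<in> (\<lambda>(u, v). biquad_conj u v) ` ({1, - 1} \<times> {1, - 1})"
    by (intro image_eqI[of _ _ "(u, v)"] SigmaI) simp_all
next
  fix \<sigma> assume "\<sigma> \<in> (\<lambda>(u, v). biquad_conj u v) ` ({1, - 1} \<times> {1, - 1})"
  then show "\<sigma> \<in> carrier biquad_galois_group"
    by (elim imageE SigmaE) (simp only: case_prod_conv biquad_conj_in_galois_group)
qed

text \<open>
  Two automorphisms already have common fixed field \<open>\<rat>\<close>: invariance under the sign change of \<open>\<surd>2\<close>
  annihilates the coordinates at \<open>\<surd>2\<close> and \<open>i \<surd>2\<close>, and invariance under that of \<open>i\<close> the one at \<open>i\<close>.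
\<close>

lemma finite_galois_extension_biquad_field:
  "finite_galois_extension complex_field biquad_field \<rat>"
proof -
  have "z \<in> \<rat>" if z: "z \<in> biquad_field" and fixed: "\<And>\<sigma>. \<sigma> \<in> carrier biquad_galois_group \<Longrightarrow> \<sigma> z = z" for z
  proof -
    from z obtain p q r s where z: "z = biquad p q r s"
      by (rule biquad_fieldE)
    have "biquad_conj (- 1) 1 z = z" "biquad_conj 1 (- 1) z = z"
      by (auto intro!: fixed biquad_conj_in_galois_group)
    then have "z = of_rat p"
      by (simp add: z biquad_of_rat)
    then show ?thesis by simp
  qed
  moreover have "\<sigma> z = z" if "\<sigma> \<in> carrier biquad_galois_group" "z \<in> \<rat>" for \<sigma> z
    using that by (rule galois_group_hom(2)[OF subfield_biquad_field])
  ultimately show ?thesis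
    unfolding finite_galois_extension_def
    using subfield_biquad_field subfield_Rats Rats_subset_biquad_field
      finite_dimension_biquad_field by auto
qed

lemma group_biquad_galois_group: "group biquad_galois_group"
  by (rule group_galois_group[OF subfieldE(1)[OF subfield_biquad_field] ring_from_type_algebra
        Rats_subset_biquad_field])

lemma biquad_conj_compose:
  "compose biquad_field (biquad_conj u v) (biquad_conj u' v') = biquad_conj (u * u') (v * v')"
proof (rule extensionalityI[of _ biquad_field])
  fix z assume "z \<in> biquad_field"
  then show "compose biquad_field (biquad_conj u v) (biquad_conj u' v') z =
      biquad_conj (u * u') (v * v') z"
    by (auto elim!: biquad_fieldE simp: compose_def mult_ac)
qed simp_all

lemma biquad_galois_group_iso:
  "biquad_galois_group \<cong> integer_mod_group 2 \<times>\<times> integer_mod_group 2"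
proof -
  let ?V = "integer_mod_group 2 \<times>\<times> integer_mod_group 2"
  define sg :: "int \<Rightarrow> rat" where "sg j = (if j = 0 then 1 else - 1)" for j
  define h where "h = (\<lambda>(j, k). biquad_conj (sg j) (sg k))"
  have carrier2: "carrier (integer_mod_group 2) = {0, 1}"
    by (auto simp: carrier_integer_mod_group)
  have sg: "bij_betw sg {0, 1} {1, - 1}"
    by (auto simp: bij_betw_def inj_on_def sg_def)
  have sg_in: "sg j \<in> {1, - 1}" for j
    by (simp add: sg_def)
  have "inj_on (\<lambda>(u, v). biquad_conj u v) ({1, - 1} \<times> {1, - 1})"
  proof (rule inj_onI, clarify)
    fix u v u' v' assume "biquad_conj u v = biquad_conj u' v'"
    then have "biquad_conj u v (biquad 0 1 1 0) = biquad_conj u' v' (biquad 0 1 1 0)"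
      by simp
    then show "u = u' \<and> v = v'" by simp
  qed
  then have "bij_betw (\<lambda>(u, v). biquad_conj u v) ({1, - 1} \<times> {1, - 1}) (carrier biquad_galois_group)"
    by (simp add: bij_betw_def galois_group_eq_biquad_conj)
  then have "bij_betw ((\<lambda>(u, v). biquad_conj u v) \<circ> map_prod sg sg) (carrier ?V) (carrier biquad_galois_group)"
    by (rule bij_betw_trans[rotated]) (use bij_betw_map_prod[OF sg sg] in \<open>simp add: carrier2\<close>)
  also have "(\<lambda>(u, v). biquad_conj u v) \<circ> map_prod sg sg = h"
    by (auto simp: h_def)
  finally have "bij_betw h (carrier ?V) (carrier biquad_galois_group)" .
  moreover have "h (x \<otimes>\<^bsub>?V\<^esub> y) = h x \<otimes>\<^bsub>biquad_galois_group\<^esub> h y"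
    if xy: "x \<in> carrier ?V" "y \<in> carrier ?V" for x y
  proof -
    have "h x \<otimes>\<^bsub>biquad_galois_group\<^esub> h y = compose biquad_field (h x) (h y)"
      by (intro mult_galois_group)
        (auto simp: h_def split: prod.split intro!: biquad_conj_in_galois_group sg_in)
    also have "\<dots> = h (x \<otimes>\<^bsub>?V\<^esub> y)"
      using xy by (auto simp: h_def biquad_conj_compose sg_def carrier2 split: prod.split)
    finally show ?thesis ..
  qed
  moreover have "h \<in> carrier ?V \<rightarrow> carrier biquad_galois_group"
    using calculation(1) by (auto simp: bij_betw_def)
  ultimately have "h \<in> iso ?V biquad_galois_group"
    by (auto simp: iso_def hom_def)
  then have "?V \<cong> biquad_galois_group"
    by (auto simp: is_iso_def)
  moreover have "group ?V"
    by (intro DirProd_group) simp_all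
  ultimately show ?thesis
    by (metis group.iso_sym)
qed

section \<open>Primitive eighth roots of unity\<close>

definition roots8 :: "complex set"
  where "roots8 = {t. t ^ 4 = - 1}"

text \<open>
  These are the numbers \<open>(u + v i) / \<surd>2\<close>: from \<open>t\<^sup>2 = \<plusminus>i\<close> the real and the imaginary part of \<open>t\<close> have
  the same square, and it is \<open>1/2\<close>.
\<close>

lemma roots8_eq_biquad:
  "roots8 = (\<lambda>(u, v). biquad 0 (u / 2) 0 (v / 2)) ` ({1, - 1} \<times> {1, - 1})"
proof (intro equalityI subsetI)
  fix t assume "t \<in> roots8"
  then have "t ^ 4 = - 1"
    by (simp add: roots8_def)
  then have "(t\<^sup>2 - \<i>) * (t\<^sup>2 + \<i>) = 0"
    by (simp add: algebra_simps power2_eq_square power4_eq_xxxx)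
  then have "t\<^sup>2 = \<i> \<or> t\<^sup>2 = - \<i>"
    by (auto simp: eq_neg_iff_add_eq_0)
  then have re: "Re t * Re t = Im t * Im t" and im: "\<bar>2 * (Re t * Im t)\<bar> = 1"
    by (auto simp: power2_eq_square complex_eq_iff mult.commute)
  then have "Im t = Re t \<or> Im t = - Re t"
    by (metis square_eq_iff)
  then have "\<bar>2 * (Re t * Re t)\<bar> = 1" and "\<bar>2 * (Im t * Im t)\<bar> = 1"
    using im by auto
  then have sq: "(2 * Re t) * (2 * Re t) = sqrt 2 * sqrt 2" "(2 * Im t) * (2 * Im t) = sqrt 2 * sqrt 2"
    by (simp_all add: abs_mult)
  then have "\<exists>u\<in>{1, - 1}. 2 * Re t = of_rat u * sqrt 2" "\<exists>v\<in>{1, - 1}. 2 * Im t = of_rat v * sqrt 2"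
    unfolding square_eq_iff by (simp_all add: of_rat_minus)
  then obtain u v :: rat where uv: "u \<in> {1, - 1}" "v \<in> {1, - 1}"
    and "2 * Re t = of_rat u * sqrt 2" "2 * Im t = of_rat v * sqrt 2"
    by blast
  then have "t = biquad 0 (u / 2) 0 (v / 2)"
    by (simp add: biquad_def complex_eq_iff of_rat_divide field_simps)
  with uv show "t \<in> (\<lambda>(u, v). biquad 0 (u / 2) 0 (v / 2)) ` ({1, - 1} \<times> {1, - 1})"
    by (intro image_eqI[of _ _ "(u, v)"] SigmaI) simp_all
next
  fix t assume "t \<in> (\<lambda>(u, v). biquad 0 (u / 2) 0 (v / 2)) ` ({1, - 1} \<times> {1, - 1})"
  then show "t \<in> roots8"
    by (auto simp: roots8_def power4_eq_xxxx biquad_mult biquad_one biquad_minus)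
qed

lemma roots8_subset_biquad_field: "roots8 \<subseteq> biquad_field"
  by (auto simp: roots8_eq_biquad)

lemma card_roots8: "card roots8 = 4"
  unfolding roots8_eq_biquad
  by (subst card_image) (auto simp: inj_on_def card_cartesian_product)

text \<open>
  An automorphism multiplies the coordinate of \<open>t\<close> at \<open>\<surd>2\<close> by \<open>u\<close> and the one at \<open>i \<surd>2\<close> by \<open>u v\<close>;
  these two signs can be prescribed independently.
\<close>

lemma galois_orbit_roots8:
  assumes "t \<in> roots8"
  shows "(\<lambda>\<sigma>. \<sigma> t) ` carrier biquad_galois_group = roots8"
proof -
  from assms obtain u v where uv: "u \<in> {1, - 1}" "v \<in> {1, - 1}" and t: "t = biquad 0 (u / 2) 0 (v / 2)"
    by (auto simp: roots8_eq_biquad)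
  show ?thesis
    using uv by (auto simp: galois_group_eq_biquad_conj roots8_eq_biquad t insert_Times_insert)
qed

lemma galois_group_maps_roots8:
  assumes "\<sigma> \<in> carrier biquad_galois_group" "t \<in> roots8"
  shows "\<sigma> t \<in> roots8"
  using galois_orbit_roots8[OF assms(2)] assms(1) by blast

section \<open>Solving the system\<close>

text \<open>
  For signs \<open>e\<close> and \<open>m\<close>, these are the roots of \<open>X\<^sup>4 - 8 t X\<^sup>2 + 8 t\<^sup>2\<close>. As \<open>t\<^sup>4 = - 1\<close>, the bracket is \<open>(t - t\<^sup>3) (1 + t)\<close> for \<open>m = 1\<close>
  and \<open>(t + t\<^sup>3) (1 - t)\<close> for \<open>m = - 1\<close>, and the first factors are square roots of \<open>2\<close> and \<open>- 2\<close>.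
\<close>

definition c_coord :: "complex \<Rightarrow> complex \<Rightarrow> complex \<Rightarrow> complex"
  where "c_coord e m t = e * (1 + t + m * t\<^sup>2 - m * t ^ 3)"

text \<open>
  The last coordinate comes from \<open>b d = 1 + s\<close> with \<open>s = - t\<^sup>2\<close>.
\<close>

definition sol :: "complex \<Rightarrow> complex \<Rightarrow> complex \<Rightarrow> complex \<Rightarrow> complex \<times> complex \<times> complex \<times> complex"
  where "sol a e m t =
    (a, t * c_coord e m t, c_coord e m t, (1 - t\<^sup>2) / (t * c_coord e m t))"

text \<open>
  After substitution of \<open>d = (1 + s) / b\<close>, the terms with a negative power of \<open>b\<close> add up to a multiple
  of \<open>s\<^sup>2 + 1\<close> in each equation, and in the last one nothing else remains.
\<close>

lemma system_reduced:
  fixes b c d :: complex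
  assumes "b \<noteq> 0"
  defines "s \<equiv> b * d - 1"
  shows "b^2 + 4 * c / b - c^2 - 4 * c * d + b * c^2 * d + 2 * b * c * d^2 = 0 \<and>
    - 2 + 2 * b * c + 2 * c^2 / b^2 - c^4 / 4 + 2 * b * d - 2 * c^2 * d / b + c^2 * d^2 = 0 \<and>
    - 2 / b^2 + 2 * d / b - d^2 = 0 \<longleftrightarrow>
    s\<^sup>2 = - 1 \<and> b\<^sup>2 = - s * c\<^sup>2 \<and> c ^ 4 = 8 * b * c + 8 * s"
    (is "?E2 = 0 \<and> ?E3 = 0 \<and> ?E4 = 0 \<longleftrightarrow> _")
proof -
  define y where "y = 1 / b"
  have yb: "b * y = 1"
    using assms(1) by (simp add: y_def)
  have d: "d = (1 + s) * y"
    using assms by (simp add: y_def)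
  have bd: "b * d = 1 + s"
    by (simp add: s_def)
  have "?E4 = - 2 * y\<^sup>2 + 2 * d * y - d\<^sup>2"
    by (simp add: y_def power_divide)
  also have "\<dots> = (- 1 - s\<^sup>2) * y\<^sup>2"
    by (simp add: d algebra_simps power2_eq_square)
  finally have E4: "?E4 = 0 \<longleftrightarrow> s\<^sup>2 = - 1"
    using yb by auto
  have "?E2 = b\<^sup>2 + 4 * c * y - c\<^sup>2 - 4 * c * d + c\<^sup>2 * (b * d) + 2 * c * d * (b * d)"
    by (simp add: y_def power2_eq_square)
  also have "\<dots> = b\<^sup>2 + s * c\<^sup>2 + 2 * c * (s\<^sup>2 + 1) * y"
    unfolding bd by (simp add: d algebra_simps power2_eq_square)
  finally have E2_eq: "?E2 = b\<^sup>2 + s * c\<^sup>2 + 2 * c * (s\<^sup>2 + 1) * y" .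
  have E2: "?E2 = 0 \<longleftrightarrow> b\<^sup>2 = - s * c\<^sup>2" if "s\<^sup>2 = - 1"
    unfolding E2_eq using that by (simp add: eq_neg_iff_add_eq_0)
  have "?E3 = - 2 + 2 * b * c + 2 * c\<^sup>2 * y\<^sup>2 - c ^ 4 / 4 + 2 * (b * d) - 2 * c\<^sup>2 * d * y + c\<^sup>2 * d\<^sup>2"
    by (simp add: y_def power_divide)
  also have "\<dots> = 2 * s + 2 * b * c - c ^ 4 / 4 + c\<^sup>2 * (s\<^sup>2 + 1) * y\<^sup>2"
    unfolding bd by (simp add: d algebra_simps power2_eq_square)
  finally have E3_eq: "?E3 = 2 * s + 2 * b * c - c ^ 4 / 4 + c\<^sup>2 * (s\<^sup>2 + 1) * y\<^sup>2" .
  have "?E3 = 0 \<longleftrightarrow> c ^ 4 = 8 * b * c + 8 * s" if "s\<^sup>2 = - 1"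
    unfolding E3_eq using that by (auto simp: field_simps)
  with E4 E2 show ?thesis by blast
qed

lemma c_coord_square:
  assumes "t \<in> roots8" "e \<in> {1, - 1}" "m \<in> {1, - 1}"
  shows "(c_coord e m t)\<^sup>2 = 2 * m * (1 + m * t)\<^sup>2"
proof -
  have t4: "t ^ 4 = - 1" using assms(1) by (simp add: roots8_def)
  have factor:
    "(1 + t + t\<^sup>2 - t ^ 3)\<^sup>2 = 2 * (1 + t)\<^sup>2 + (t ^ 4 + 1) * (t\<^sup>2 - 2 * t - 1)"
    "(1 + t - t\<^sup>2 + t ^ 3)\<^sup>2 = - 2 * (1 - t)\<^sup>2 + (t ^ 4 + 1) * (t\<^sup>2 - 2 * t + 3)"
    by (simp_all add: algebra_simps power2_eq_square power3_eq_cube power4_eq_xxxx)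
  have "(1 + t + t\<^sup>2 - t ^ 3)\<^sup>2 = 2 * (1 + t)\<^sup>2" "(1 + t - t\<^sup>2 + t ^ 3)\<^sup>2 = - 2 * (1 - t)\<^sup>2"
    using t4 factor by simp_all
  with assms(2,3) show ?thesis
    by (auto simp: c_coord_def power_mult_distrib)
qed

text \<open>
  The quartic is the product of \<open>c\<^sup>2 - 2 (1 + t)\<^sup>2\<close> and \<open>c\<^sup>2 + 2 (1 - t)\<^sup>2\<close> because \<open>t\<^sup>4 = - 1\<close>; by
  lemma \<open>c_coord_square\<close> each factor is a difference of two squares.
\<close>

lemma c_coord_quartic:
  assumes "t \<in> roots8"
  shows "c ^ 4 = 8 * t * c\<^sup>2 - 8 * t\<^sup>2 \<longleftrightarrow> (\<exists>e\<in>{1, - 1}. \<exists>m\<in>{1, - 1}. c = c_coord e m t)"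
proof -
  have t4: "t ^ 4 = - 1" using assms by (simp add: roots8_def)
  have "c ^ 4 = 8 * t * c\<^sup>2 - 8 * t\<^sup>2 \<longleftrightarrow> (c\<^sup>2 - 2 * (1 + t)\<^sup>2) * (c\<^sup>2 + 2 * (1 - t)\<^sup>2) = 0"
  proof -
    have "(c\<^sup>2 - 2 * (1 + t)\<^sup>2) * (c\<^sup>2 + 2 * (1 - t)\<^sup>2) =
        c ^ 4 - (8 * t * c\<^sup>2 - 8 * t\<^sup>2) - 4 * (t ^ 4 + 1)"
      by (simp add: algebra_simps power2_eq_square power4_eq_xxxx)
    with t4 show ?thesis by simp
  qed
  also have "\<dots> \<longleftrightarrow> (\<exists>m\<in>{1, - 1}. c\<^sup>2 = 2 * m * (1 + m * t)\<^sup>2)"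
    by (auto simp: add_eq_0_iff2)
  also have "\<dots> \<longleftrightarrow> (\<exists>m\<in>{1, - 1}. c\<^sup>2 = (c_coord 1 m t)\<^sup>2)"
    using c_coord_square[OF assms, of 1] by simp
  also have "\<dots> \<longleftrightarrow> (\<exists>e\<in>{1, - 1}. \<exists>m\<in>{1, - 1}. c = c_coord e m t)"
    by (auto simp: power2_eq_iff c_coord_def algebra_simps)
  finally show ?thesis .
qed

text \<open>
  By its square, \<open>c\<close> could vanish only for \<open>t = \<plusminus>1\<close>.
\<close>

lemma c_coord_nonzero:
  assumes "t \<in> roots8" "e \<in> {1, - 1}" "m \<in> {1, - 1}"
  shows "c_coord e m t \<noteq> 0"
proof
  assume "c_coord e m t = 0"
  with c_coord_square[OF assms] assms(3) have "1 + m * t = 0"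
    by auto
  then have "m * t = - 1"
    by (simp add: add_eq_0_iff)
  then have "m ^ 4 * t ^ 4 = 1"
    by (simp flip: power_mult_distrib)
  with assms(1,3) show False by (auto simp: roots8_def)
qed

lemma solutions_eq:
  "solutions = (\<lambda>((a, e, m), t). sol a e m t) ` (({1, - 1} \<times> {1, - 1} \<times> {1, - 1}) \<times> roots8)"
    (is "_ = ?S")
proof (intro equalityI subsetI)
  fix x assume x: "x \<in> solutions"
  obtain a b c d where x_eq: "x = (a, b, c, d)"
    by (cases x)
  define s where "s = b * d - 1"
  have b: "b \<noteq> 0" and "a\<^sup>2 = 1"
    and s: "s\<^sup>2 = - 1" "b\<^sup>2 = - s * c\<^sup>2" and c4: "c ^ 4 = 8 * b * c + 8 * s"
    using x system_reduced[of b c d] by (simp_all add: solutions_def x_eq s_def)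
  then have a: "a \<in> {1, - 1}"
    by (auto simp: power2_eq_1_iff)
  have c: "c \<noteq> 0"
    using b s(2) by auto
  define t where "t = b / c"
  have bt: "b = t * c"
    using c by (simp add: t_def)
  have "t\<^sup>2 * c\<^sup>2 = (- s) * c\<^sup>2"
    using s(2) by (simp add: bt power_mult_distrib)
  then have st: "s = - t\<^sup>2"
    using c by (simp only: mult_cancel_right) simp
  have t: "t \<in> roots8"
    using s(1) by (simp add: st roots8_def)
  have "c ^ 4 = 8 * t * c\<^sup>2 - 8 * t\<^sup>2"
    using c4 by (simp add: bt st power2_eq_square)
  then obtain e m where em: "e \<in> {1, - 1}" "m \<in> {1, - 1}" "c = c_coord e m t"
    using c_coord_quartic[OF t] by blast
  have "b * d = 1 - t\<^sup>2"
    using st by (simp add: s_def algebra_simps)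
  then have "d = (1 - t\<^sup>2) / b"
    using b by (simp add: nonzero_eq_divide_eq mult.commute)
  then have "d = (1 - t\<^sup>2) / (t * c)"
    by (simp only: bt)
  then have "x = sol a e m t"
    by (simp add: x_eq sol_def bt em(3)[symmetric])
  with a em t show "x \<in> ?S"
    by (intro image_eqI[of _ _ "((a, e, m), t)"] SigmaI) simp_all
next
  fix x assume "x \<in> ?S"
  then obtain a e m t where x: "x = sol a e m t"
    and a: "a \<in> {1, - 1}" and em: "e \<in> {1, - 1}" "m \<in> {1, - 1}" and t: "t \<in> roots8"
    by auto
  define c where "c = c_coord e m t"
  define b where "b = t * c"
  define d where "d = (1 - t\<^sup>2) / (t * c)"
  have b: "b \<noteq> 0"
    using c_coord_nonzero[OF t em] t by (auto simp: b_def c_def roots8_def)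
  have s: "b * d - 1 = - t\<^sup>2"
    using b by (simp add: b_def d_def)
  have "c ^ 4 = 8 * t * c\<^sup>2 - 8 * t\<^sup>2"
    using c_coord_quartic[OF t] em by (auto simp: c_def)
  then have "(- t\<^sup>2)\<^sup>2 = - 1 \<and> b\<^sup>2 = - (- t\<^sup>2) * c\<^sup>2 \<and> c ^ 4 = 8 * b * c + 8 * (- t\<^sup>2)"
    using t by (simp add: roots8_def b_def power2_eq_square power4_eq_xxxx mult_ac)
  moreover have "a\<^sup>2 = 1"
    using a by auto
  ultimately have "(a, b, c, d) \<in> solutions"
    using system_reduced[OF b, of c d] b unfolding s solutions_def mem_Collect_eq case_prod_conv
    by blast
  then show "x \<in> solutions"
    by (simp add: x sol_def b_def c_def d_def)
qed

lemma solutionE: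
  assumes "x \<in> solutions"
  obtains a e m t where "x = sol a e m t" "a \<in> {1, - 1}" "e \<in> {1, - 1}" "m \<in> {1, - 1}" "t \<in> roots8"
  using assms unfolding solutions_eq by force

lemma sol_in_solutions:
  assumes "a \<in> {1, - 1}" "e \<in> {1, - 1}" "m \<in> {1, - 1}" "t \<in> roots8"
  shows "sol a e m t \<in> solutions"
  unfolding solutions_eq by (rule image_eqI[of _ _ "((a, e, m), t)"]) (use assms in auto)

text \<open>
  The quotient of the coordinates \<open>b\<close> and \<open>c\<close> recovers \<open>t\<close>, the square of \<open>c\<close> recovers \<open>m\<close>, and then
  \<open>c\<close> recovers \<open>e\<close>.
\<close>

lemma sol_inject:
  assumes em: "e \<in> {1, - 1}" "m \<in> {1, - 1}" "e' \<in> {1, - 1}" "m' \<in> {1, - 1}"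
    and t: "t \<in> roots8" "t' \<in> roots8" and eq: "sol a e m t = sol a' e' m' t'"
  shows "a = a' \<and> e = e' \<and> m = m' \<and> t = t'"
proof -
  from eq have a: "a = a'" and c: "c_coord e m t = c_coord e' m' t'"
    and "t * c_coord e m t = t' * c_coord e' m' t'"
    unfolding sol_def prod.inject by blast+
  then have tt': "t = t'"
    using c_coord_nonzero[OF t(2) em(3,4)] by simp
  have t4: "t ^ 4 = - 1"
    using t by (simp add: roots8_def)
  \<comment> \<open>If the two squares agreed, then \<open>(1 + m t)\<^sup>2 + (1 - m t)\<^sup>2\<close> would vanish, so \<open>t\<^sup>2 = - 1\<close>.\<close>
  have "m = m'"
  proof (rule ccontr)
    assume "m \<noteq> m'"
    then have m': "m' = - m" using em by auto
    have "(c_coord e m t)\<^sup>2 = (c_coord e' m' t)\<^sup>2"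
      using c tt' by simp
    then have "2 * m * (1 + m * t)\<^sup>2 = 2 * m' * (1 + m' * t)\<^sup>2"
      using c_coord_square[OF t(1)] em by simp
    then have "4 * m * (1 + m\<^sup>2 * t\<^sup>2) = 0"
      by (simp add: m' power2_eq_square algebra_simps)
    moreover have "m \<noteq> 0" "m\<^sup>2 = 1"
      using em by auto
    ultimately have "t\<^sup>2 = - 1"
      by (simp add: add_eq_0_iff)
    then have "t ^ 4 = 1"
      by (simp add: power4_eq_xxxx power2_eq_square)
    with t4 show False by simp
  qed
  moreover have "e = e'"
    using c em c_coord_nonzero[OF t(1), of e m] \<open>m = m'\<close> tt'
    by (auto simp: c_coord_def)
  ultimately show ?thesis
    using a tt' by simp
qed

section \<open>The Galois action on the solutions\<close>

lemma solution_coordinates_in_biquad_field: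
  assumes "e \<in> {1, - 1}" "m \<in> {1, - 1}" "t \<in> roots8"
  shows "c_coord e m t \<in> biquad_field" "t * c_coord e m t \<in> biquad_field"
    "(1 - t\<^sup>2) / (t * c_coord e m t) \<in> biquad_field"
proof -
  have t: "t \<in> biquad_field"
    using assms(3) roots8_subset_biquad_field by blast
  have signs: "e \<in> biquad_field" "m \<in> biquad_field"
    using assms biquad_field_closed(1,4) by auto
  show c: "c_coord e m t \<in> biquad_field"
    unfolding c_coord_def by (intro biquad_field_closed signs t)
  then show b: "t * c_coord e m t \<in> biquad_field"
    by (intro biquad_field_closed t)
  show "(1 - t\<^sup>2) / (t * c_coord e m t) \<in> biquad_field"
    unfolding divide_inverse by (intro biquad_field_closed(1,5-7) biquad_field_closed(3)[OF _ biquad_field_closed(5)] b t)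
qed

text \<open>
  Every coordinate is a rational function of \<open>t\<close>. Conversely \<open>t = b / c\<close> lies in the solution field,
  and two of these roots of unity yield \<open>\<surd>2\<close> and \<open>i\<close>.
\<close>

lemma solution_field_eq: "solution_field = biquad_field"
proof
  interpret field complex_field ..
  let ?gens = "\<rat> \<union> (\<Union>(a, b, c, d)\<in>solutions. {a, b, c, d})"
  show "solution_field \<subseteq> biquad_field"
    unfolding solution_field_def
  proof (rule generate_field_min_subfield1[OF _ subfield_biquad_field])
    have "{a, b, c, d} \<subseteq> biquad_field" if "(a, b, c, d) \<in> solutions" for a b c d
    proof -
      from that obtain e m t where "(a, b, c, d) = sol a e m t" "a \<in> {1, - 1}"
        and emt: "e \<in> {1, - 1}" "m \<in> {1, - 1}" "t \<in> roots8"
        by (auto simp: solutions_eq sol_def)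
      moreover have "a \<in> biquad_field"
        using \<open>a \<in> {1, - 1}\<close> biquad_field_closed(1,4) by auto
      ultimately show ?thesis
        using solution_coordinates_in_biquad_field[OF emt] by (simp add: sol_def)
    qed
    then show "?gens \<subseteq> biquad_field"
      using Rats_subset_biquad_field by blast
  qed simp
  have L: "subfield solution_field complex_field"
    unfolding solution_field_def by (rule generate_field_is_subfield) simp
  note closed = subfield_type_algebraD[OF L]
  have gens: "?gens \<subseteq> solution_field"
    unfolding solution_field_def by (auto intro: generate_field.incl)
  have roots: "t \<in> solution_field" if t: "t \<in> roots8" for t
  proof -
    have "sol 1 1 1 t \<in> solutions"
      using t by (intro sol_in_solutions) simp_all
    then have "c_coord 1 1 t \<in> solution_field" "t * c_coord 1 1 t \<in> solution_field"
      using gens by (auto simp: sol_def)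
    then have "(t * c_coord 1 1 t) * inverse (c_coord 1 1 t) \<in> solution_field"
      using closed(3,5) by blast
    moreover have "(t * c_coord 1 1 t) * inverse (c_coord 1 1 t) = t"
      using c_coord_nonzero[OF t, of 1 1] by (simp add: mult.assoc)
    ultimately show ?thesis
      by (simp only:)
  qed
  show "biquad_field \<subseteq> solution_field"
  proof
    fix z assume "z \<in> biquad_field"
    then obtain p q r s where z: "z = biquad p q r s"
      by (rule biquad_fieldE)
    let ?t = "biquad 0 (1 / 2) 0 (1 / 2)" and ?t' = "biquad 0 (1 / 2) 0 (- 1 / 2)"
    have t: "?t \<in> solution_field" "?t' \<in> solution_field"
      by (rule roots, force simp: roots8_eq_biquad)+
    have "biquad 0 1 0 0 = ?t + ?t'" "biquad 0 0 1 0 = ?t * ?t"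
      by (simp_all add: biquad_add biquad_mult)
    then have "biquad 0 1 0 0 \<in> solution_field" "biquad 0 0 1 0 \<in> solution_field"
      using closed t by metis+
    moreover have "of_rat x \<in> solution_field" for x
      using gens by auto
    ultimately show "z \<in> solution_field"
      unfolding z by (subst biquad_expand) (intro closed)
  qed
qed

text \<open>
  For fixed signs the coordinates are rational functions of \<open>t\<close> with rational coefficients, and
  such functions commute with automorphisms.
\<close>

lemma coordinatewise_sol:
  assumes \<sigma>: "\<sigma> \<in> carrier biquad_galois_group"
    and aem: "a \<in> {1, - 1}" "e \<in> {1, - 1}" "m \<in> {1, - 1}" and t: "t \<in> roots8"
  shows "coordinatewise \<sigma> (sol a e m t) = sol a e m (\<sigma> t)"
proof -
  note hom = galois_group_hom[OF subfield_biquad_field \<sigma>]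
  note coords = solution_coordinates_in_biquad_field[OF aem(2,3) t]
  have tK [simp]: "t \<in> biquad_field"
    using t roots8_subset_biquad_field by blast
  have sign: "\<sigma> x = x" "x \<in> biquad_field" if "x \<in> {1, - 1}" for x
    using hom(2)[of x] that biquad_field_closed(1,4) by auto
  have "\<sigma> (c_coord e m t) = c_coord e m (\<sigma> t)"
    unfolding c_coord_def
    by (simp add: hom biquad_field_closed sign[OF aem(2)] sign[OF aem(3)] sign[of 1])
  moreover have "\<sigma> (1 - t\<^sup>2) = 1 - (\<sigma> t)\<^sup>2"
    by (simp add: hom biquad_field_closed sign[of 1])
  moreover have "sol a e m t \<in> solutions"
    by (rule sol_in_solutions[OF aem t])
  moreover have "1 - t\<^sup>2 \<in> biquad_field"
    by (intro biquad_field_closed tK)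
  ultimately show ?thesis
    using coords by (simp add: coordinatewise_def sol_def hom sign[OF aem(1)])
qed

lemma group_action_solutions: "group_action biquad_galois_group solutions coordinatewise"
proof (rule group_actionI[OF group_biquad_galois_group])
  show "coordinatewise \<sigma> \<in> extensional solutions" for \<sigma>
    by (simp add: coordinatewise_def)
next
  fix \<sigma> x assume "\<sigma> \<in> carrier biquad_galois_group" "x \<in> solutions"
  then show "coordinatewise \<sigma> x \<in> solutions"
    by (elim solutionE) (simp add: coordinatewise_sol sol_in_solutions galois_group_maps_roots8)
next
  fix \<sigma> \<tau> x assume \<sigma>\<tau>: "\<sigma> \<in> carrier biquad_galois_group" "\<tau> \<in> carrier biquad_galois_group"
    and "x \<in> solutions"
  then obtain a e m t where x: "x = sol a e m t"
    and aem: "a \<in> {1, - 1}" "e \<in> {1, - 1}" "m \<in> {1, - 1}" and t: "t \<in> roots8"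
    by (elim solutionE)
  have "t \<in> biquad_field"
    using t roots8_subset_biquad_field by blast
  then have "(\<sigma> \<otimes>\<^bsub>biquad_galois_group\<^esub> \<tau>) t = \<sigma> (\<tau> t)"
    using mult_galois_group[OF \<sigma>\<tau>] by (simp add: compose_def)
  moreover have "\<sigma> \<otimes>\<^bsub>biquad_galois_group\<^esub> \<tau> \<in> carrier biquad_galois_group"
    using \<sigma>\<tau> group_biquad_galois_group by (simp add: group.is_monoid monoid.m_closed)
  ultimately show "coordinatewise (\<sigma> \<otimes>\<^bsub>biquad_galois_group\<^esub> \<tau>) x =
      coordinatewise \<sigma> (coordinatewise \<tau> x)"
    using \<sigma>\<tau> aem t by (simp only: x coordinatewise_sol galois_group_maps_roots8)
next
  fix x assume "x \<in> solutions"
  then show "coordinatewise \<one>\<^bsub>biquad_galois_group\<^esub> x = x"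
  proof (elim solutionE)
    fix a e m t assume x: "x = sol a e m t"
      and aem: "a \<in> {1, - 1}" "e \<in> {1, - 1}" "m \<in> {1, - 1}" and t: "t \<in> roots8"
    have "\<one>\<^bsub>biquad_galois_group\<^esub> \<in> carrier biquad_galois_group"
      using group_biquad_galois_group by (simp add: group.is_monoid)
    moreover have "\<one>\<^bsub>biquad_galois_group\<^esub> t = t"
      using t roots8_subset_biquad_field by (auto simp: one_galois_group)
    ultimately show ?thesis
      using aem t by (simp only: x coordinatewise_sol)
  qed
qed

text \<open>
  The action changes only the parameter \<open>t\<close>, and on that parameter it is transitive.
\<close>

lemma orbits_solutions:
  "orbits biquad_galois_group solutions coordinatewise =
    (\<lambda>(a, e, m). sol a e m ` roots8) ` ({1, - 1} \<times> {1, - 1} \<times> {1, - 1})"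
proof -
  have orbit: "orbit biquad_galois_group coordinatewise (sol a e m t) = sol a e m ` roots8"
    if aem: "a \<in> {1, - 1}" "e \<in> {1, - 1}" "m \<in> {1, - 1}" and t: "t \<in> roots8" for a e m t
  proof -
    have "orbit biquad_galois_group coordinatewise (sol a e m t) =
        (\<lambda>\<sigma>. coordinatewise \<sigma> (sol a e m t)) ` carrier biquad_galois_group"
      unfolding orbit_def by blast
    also have "\<dots> = (\<lambda>\<sigma>. sol a e m (\<sigma> t)) ` carrier biquad_galois_group"
      by (intro image_cong refl coordinatewise_sol aem t)
    also have "\<dots> = sol a e m ` roots8"
      by (simp only: galois_orbit_roots8[OF t, symmetric] image_image)
    finally show ?thesis .
  qed
  obtain t0 where t0: "t0 \<in> roots8"
    using card_roots8 by fastforce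
  show ?thesis
  proof (intro equalityI subsetI)
    fix S assume "S \<in> orbits biquad_galois_group solutions coordinatewise"
    then obtain x where "x \<in> solutions" and S: "S = orbit biquad_galois_group coordinatewise x"
      unfolding orbits_def by blast
    then show "S \<in> (\<lambda>(a, e, m). sol a e m ` roots8) ` ({1, - 1} \<times> {1, - 1} \<times> {1, - 1})"
    proof (elim solutionE)
      fix a e m t assume "x = sol a e m t" "a \<in> {1, - 1}" "e \<in> {1, - 1}" "m \<in> {1, - 1}" "t \<in> roots8"
      then show ?thesis
        unfolding S by (intro image_eqI[of _ _ "(a, e, m)"] SigmaI) (simp_all only: orbit case_prod_conv)
    qed
  next
    fix S assume "S \<in> (\<lambda>(a, e, m). sol a e m ` roots8) ` ({1, - 1} \<times> {1, - 1} \<times> {1, - 1})"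
    then obtain a e m where aem: "a \<in> {1, - 1}" "e \<in> {1, - 1}" "m \<in> {1, - 1}"
      and S: "S = sol a e m ` roots8"
      by (elim imageE SigmaE) (simp only: case_prod_conv)
    show "S \<in> orbits biquad_galois_group solutions coordinatewise"
      unfolding orbits_def S using orbit[OF aem t0] sol_in_solutions[OF aem t0] by blast
  qed
qed

lemma card_orbit_solutions:
  assumes "a \<in> {1, - 1}" "e \<in> {1, - 1}" "m \<in> {1, - 1}"
  shows "card (sol a e m ` roots8) = 4"
proof -
  have "inj_on (sol a e m) roots8"
  proof (rule inj_onI)
    fix t t' assume "t \<in> roots8" "t' \<in> roots8" "sol a e m t = sol a e m t'"
    then show "t = t'"
      using sol_inject[OF assms(2,3) assms(2,3)] by blast
  qed
  then show ?thesis
    by (simp add: card_image card_roots8)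
qed

lemma card_orbits_solutions:
  "card (orbits biquad_galois_group solutions coordinatewise) = 8"
proof -
  let ?I = "{1, - 1} \<times> {1, - 1} \<times> {1, - 1 :: complex}"
  obtain t where t: "t \<in> roots8"
    using card_roots8 by fastforce
  have "inj_on (\<lambda>(a, e, m). sol a e m ` roots8) ?I"
  proof (rule inj_onI)
    fix i j assume ij: "i \<in> ?I" "j \<in> ?I"
      and eq: "(\<lambda>(a, e, m). sol a e m ` roots8) i = (\<lambda>(a, e, m). sol a e m ` roots8) j"
    obtain a e m a' e' m' where i: "i = (a, e, m)" and j: "j = (a', e', m')"
      by (cases i, cases j)
    from eq t obtain t' where "t' \<in> roots8" "sol a e m t = sol a' e' m' t'"
      unfolding i j by blast
    then show "i = j"
      using sol_inject[of e m e' m' t t' a a'] ij t unfolding i j mem_Sigma_iff by blast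
  qed
  then show ?thesis
    unfolding orbits_solutions by (simp add: card_image card_cartesian_product)
qed

theorem proposition3p2:
  shows "finite_galois_extension complex_field solution_field \<rat> \<and>
    solution_galois_group \<cong> integer_mod_group 2 \<times>\<times> integer_mod_group 2 \<and>
    group_action solution_galois_group solutions coordinatewise \<and>
    card (orbits solution_galois_group solutions coordinatewise) = 8 \<and>
    (\<forall>orb\<in>orbits solution_galois_group solutions coordinatewise. card orb = 4)"
proof (intro conjI ballI)
  fix orb assume "orb \<in> orbits solution_galois_group solutions coordinatewise"
  then obtain a e m where "a \<in> {1, - 1}" "e \<in> {1, - 1}" "m \<in> {1, - 1}"
    and "orb = sol a e m ` roots8"
    unfolding solution_field_eq orbits_solutions
    by (elim imageE SigmaE) (simp only: case_prod_conv)
  then show "card orb = 4"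
    using card_orbit_solutions by blast
qed (simp_all only: solution_field_eq finite_galois_extension_biquad_field biquad_galois_group_iso
    group_action_solutions card_orbits_solutions)

end
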